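(* Let $p,n\ge 1$ and let $X_1,\dots,X_n$ be independent (not necessarily identically distributed) random variables on $\mathbb{R}^p$. Fix one of the two notions of spherical or central symmetry, and suppose that for every $i=1,\dots,n$, $X_i$ is symmetric about $\mu_i\in\mathbb{R}^p$ in this sense. Then for any $\lambda_1,\dots,\lambda_n\in\mathbb{R}$ and $b\in\mathbb{R}^p$, the random variable $\sum_{i=1}^n\lambda_iX_i+b$ is symmetric about $\sum_{i=1}^n\lambda_i\mu_i+b$ with respect to the same notion of symmetry.
   Context: A random variable $X$ in $\mathbb{R}^p$ is spherically symmetric about $\mu\in\mathbb{R}^p$ if $X-\mu$ and $U(X-\mu)$ are identically distributed for every orthonormal (orthogonal) $p\times p$ matrix $U$. It is centrally symmetric about $\mu$ if $X-\mu$ and $\mu-X$ are identically distributed. *)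

theory Defs
  imports "HOL-Probability.Probability"
begin

definition spherically_symmetric_about ::
    "'w measure \<Rightarrow> ('w \<Rightarrow> real ^ 'p) \<Rightarrow> real ^ 'p \<Rightarrow> bool" where
  "spherically_symmetric_about M X \<mu> \<longleftrightarrow>
     X \<in> borel_measurable M \<and>
     (\<forall>U :: real ^ 'p ^ 'p. orthogonal_matrix U \<longrightarrow>
        distr M borel (\<lambda>\<omega>. X \<omega> - \<mu>) = distr M borel (\<lambda>\<omega>. U *v (X \<omega> - \<mu>)))"

definition centrally_symmetric_about ::
    "'w measure \<Rightarrow> ('w \<Rightarrow> real ^ 'p) \<Rightarrow> real ^ 'p \<Rightarrow> bool" where
  "centrally_symmetric_about M X \<mu> \<longleftrightarrow>
     X \<in> borel_measurable M \<and>
     distr M borel (\<lambda>\<omega>. X \<omega> - \<mu>) = distr M borel (\<lambda>\<omega>. \<mu> - X \<omega>)"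

end

theory Submission
  imports Defs
begin

text \<open>
  Both notions have the same shape: the law of the centred variable \<open>Z = X - \<mu>\<close> is unchanged by
  certain linear maps \<open>T\<close>, namely all orthogonal maps in the spherical case and \<open>z \<mapsto> -z\<close> in the
  central case. So it is enough to treat one \<open>T\<close> at a time.

  The centred combination is \<open>S = (\<Sum>i. c i *\<^sub>R Z i)\<close>, since the shift \<open>b\<close> cancels, and linearity
  gives \<open>T S = (\<Sum>i. c i *\<^sub>R T (Z i))\<close>. Hence \<open>S\<close> and \<open>T S\<close> arise by applying one measurable
  function to the families \<open>Z\<close> and \<open>T \<circ> Z\<close>. Each family is independent, so its joint law is the
  product of its marginals; as the marginals agree by symmetry, so do the joint laws
  (\<open>distr_fun_eq_of_indep_vars\<close>) and therefore the laws of \<open>S\<close> and \<open>T S\<close>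
  (\<open>distr_sum_scaleR_linear_invariant\<close>).
\<close>

text \<open>
  Independence makes the joint law the product of the marginals, so the marginals determine the
  law of every measurable function of the whole family.
\<close>

lemma (in prob_space) distr_fun_eq_of_indep_vars:
  assumes "I \<noteq> {}"
    and Y: "indep_vars N Y I" and Z: "indep_vars N Z I"
    and marginals: "\<And>i. i \<in> I \<Longrightarrow> distr M (N i) (Y i) = distr M (N i) (Z i)"
    and f: "f \<in> measurable (PiM I N) L"
  shows "distr M L (\<lambda>\<omega>. f (\<lambda>i\<in>I. Y i \<omega>)) = distr M L (\<lambda>\<omega>. f (\<lambda>i\<in>I. Z i \<omega>))"
proof -
  have rv: "random_variable (N i) (Y i)" "random_variable (N i) (Z i)" if "i \<in> I" for i
    using Y Z that by (auto simp: indep_vars_def)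
  have joint_meas: "(\<lambda>\<omega>. \<lambda>i\<in>I. Y i \<omega>) \<in> measurable M (PiM I N)"
    "(\<lambda>\<omega>. \<lambda>i\<in>I. Z i \<omega>) \<in> measurable M (PiM I N)"
    using rv by (auto intro: measurable_restrict)
  have "distr M (PiM I N) (\<lambda>\<omega>. \<lambda>i\<in>I. Y i \<omega>) = PiM I (\<lambda>i. distr M (N i) (Y i))"
    using indep_vars_iff_distr_eq_PiM'[of I Y N] \<open>I \<noteq> {}\<close> rv Y by simp
  also have "\<dots> = PiM I (\<lambda>i. distr M (N i) (Z i))"
    using marginals by (intro PiM_cong) auto
  also have "\<dots> = distr M (PiM I N) (\<lambda>\<omega>. \<lambda>i\<in>I. Z i \<omega>)"
    using indep_vars_iff_distr_eq_PiM'[of I Z N] \<open>I \<noteq> {}\<close> rv Z by simp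
  finally have "distr (distr M (PiM I N) (\<lambda>\<omega>. \<lambda>i\<in>I. Y i \<omega>)) L f
      = distr (distr M (PiM I N) (\<lambda>\<omega>. \<lambda>i\<in>I. Z i \<omega>)) L f"
    by simp
  then show ?thesis
    using distr_distr[OF f joint_meas(1)] distr_distr[OF f joint_meas(2)] by (simp add: comp_def)
qed

text \<open>
  A linear map commutes with linear combinations, so invariance of the marginals under \<open>T\<close>
  passes to the combination: \<open>T\<close> may be moved onto each \<open>Z i\<close>, which keeps the family independent.
\<close>

lemma (in prob_space) distr_sum_scaleR_linear_invariant:
  fixes Z :: "'i \<Rightarrow> 'a \<Rightarrow> 'b::euclidean_space" and T :: "'b \<Rightarrow> 'b"
  assumes "I \<noteq> {}"
    and indep: "indep_vars (\<lambda>_. borel) Z I"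
    and "linear T"
    and inv: "\<And>i. i \<in> I \<Longrightarrow> distr M borel (Z i) = distr M borel (\<lambda>\<omega>. T (Z i \<omega>))"
  shows "distr M borel (\<lambda>\<omega>. \<Sum>i\<in>I. c i *\<^sub>R Z i \<omega>)
    = distr M borel (\<lambda>\<omega>. T (\<Sum>i\<in>I. c i *\<^sub>R Z i \<omega>))"
proof -
  have T_meas: "T \<in> borel_measurable borel"
    using \<open>linear T\<close> by (intro borel_measurable_continuous_onI linear_continuous_on)
      (simp add: linear_conv_bounded_linear)
  have indep_T: "indep_vars (\<lambda>_. borel) (\<lambda>i \<omega>. T (Z i \<omega>)) I"
    using indep_vars_compose2[OF indep, of "\<lambda>_. T"] T_meas by simp
  have "(\<lambda>z :: 'i \<Rightarrow> 'b. \<Sum>i\<in>I. c i *\<^sub>R z i) \<in> borel_measurable (PiM I (\<lambda>_. borel))"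
    by (intro borel_measurable_sum borel_measurable_scaleR borel_measurable_const
        measurable_component_singleton)
  from distr_fun_eq_of_indep_vars[OF \<open>I \<noteq> {}\<close> indep indep_T inv this]
  show ?thesis
    using \<open>linear T\<close> by (simp add: linear_sum linear_scale)
qed

theorem proposition3:
  fixes M :: "'w measure" and n :: nat
    and X :: "nat \<Rightarrow> 'w \<Rightarrow> real ^ 'p" and \<mu> :: "nat \<Rightarrow> real ^ 'p"
    and c :: "nat \<Rightarrow> real" and b :: "real ^ 'p"
  assumes "prob_space M"
    and "n \<ge> 1"
    and "prob_space.indep_vars M (\<lambda>_. borel) X {1..n}"
  shows "((\<forall>i\<in>{1..n}. spherically_symmetric_about M (X i) (\<mu> i)) \<longrightarrow>
            spherically_symmetric_about M
              (\<lambda>\<omega>. (\<Sum>i=1..n. c i *\<^sub>R X i \<omega>) + b) ((\<Sum>i=1..n. c i *\<^sub>R \<mu> i) + b)) \<and>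
         ((\<forall>i\<in>{1..n}. centrally_symmetric_about M (X i) (\<mu> i)) \<longrightarrow>
            centrally_symmetric_about M
              (\<lambda>\<omega>. (\<Sum>i=1..n. c i *\<^sub>R X i \<omega>) + b) ((\<Sum>i=1..n. c i *\<^sub>R \<mu> i) + b))"
proof -
  interpret prob_space M by fact
  let ?S = "\<lambda>\<omega>. (\<Sum>i=1..n. c i *\<^sub>R X i \<omega>) + b" and ?m = "(\<Sum>i=1..n. c i *\<^sub>R \<mu> i) + b"
  have X_meas: "X i \<in> borel_measurable M" if "i \<in> {1..n}" for i
    using assms(3) that by (auto simp: indep_vars_def)
  have S_meas: "?S \<in> borel_measurable M"
    using X_meas by measurable
  have indep: "indep_vars (\<lambda>_. borel) (\<lambda>i \<omega>. X i \<omega> - \<mu> i) {1..n}"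
    using indep_vars_compose2[OF assms(3), of "\<lambda>i x. x - \<mu> i"] by simp
  have centred: "(\<Sum>i=1..n. c i *\<^sub>R (X i \<omega> - \<mu> i)) = ?S \<omega> - ?m" for \<omega>
    by (simp add: scaleR_diff_right sum_subtractf)
  have inv: "distr M borel (\<lambda>\<omega>. ?S \<omega> - ?m) = distr M borel (\<lambda>\<omega>. T (?S \<omega> - ?m))"
    if "linear T"
      and "\<And>i. i \<in> {1..n} \<Longrightarrow>
        distr M borel (\<lambda>\<omega>. X i \<omega> - \<mu> i) = distr M borel (\<lambda>\<omega>. T (X i \<omega> - \<mu> i))"
    for T :: "real ^ 'p \<Rightarrow> real ^ 'p"
    using distr_sum_scaleR_linear_invariant[OF _ indep that, of c] \<open>n \<ge> 1\<close>
    unfolding centred by simp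
  show ?thesis
  proof (intro conjI impI)
    assume "\<forall>i\<in>{1..n}. spherically_symmetric_about M (X i) (\<mu> i)"
    then show "spherically_symmetric_about M ?S ?m"
      using S_meas inv[OF matrix_vector_mul_linear]
      unfolding spherically_symmetric_about_def by blast
  next
    assume "\<forall>i\<in>{1..n}. centrally_symmetric_about M (X i) (\<mu> i)"
    then have "distr M borel (\<lambda>\<omega>. X i \<omega> - \<mu> i) = distr M borel (\<lambda>\<omega>. - (X i \<omega> - \<mu> i))"
      if "i \<in> {1..n}" for i
      using that by (simp add: centrally_symmetric_about_def)
    from inv[OF linear_uminus this] show "centrally_symmetric_about M ?S ?m"
      unfolding centrally_symmetric_about_def minus_diff_eq using S_meas by blast
  qed
qed

end
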